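(* Let $f:\Delta\to\Delta$ be the projective (unsorted) Brun algorithm on the simplex $\Delta=\{(x_1,x_2,x_3)\in\mathbb{R}^3 \mid x_1>0,\ x_2>0,\ x_3>0,\ x_1+x_2+x_3=1\}$ (as defined in the context, up to a set of Lebesgue measure $0$). Define $\delta$ almost everywhere on $\Delta$ by $$\delta(\mathbf{x})=\frac{1}{2\,x_{\pi(2)}(1-x_{\pi(2)})(1-x_{\pi(1)}-x_{\pi(2)})}\qquad\text{for }\mathbf{x}=(x_1,x_2,x_3)\in\Lambda_\pi\cap\Delta,\ \pi\in S_3 .$$ Then $\delta$ is the density, with respect to the Lebesgue measure $dx_1\,dx_2$ on $\Delta$, of an $f$-invariant measure; that is, the measure $\mu$ given by $d\mu=\delta\,dx_1\,dx_2$ satisfies $\mu(f^{-1}(B))=\mu(B)$ for every Borel set $B\subseteq\Delta$.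
   Context: Let $\Lambda=\{(x_1,x_2,x_3)\in\mathbb{R}^3\mid x_1>0,x_2>0,x_3>0\}$ and, for each permutation $\pi$ in the group $S_3$ of permutations of $\{1,2,3\}$, let $\Lambda_\pi=\{(x_1,x_2,x_3)\in\Lambda\mid x_{\pi(1)}<x_{\pi(2)}<x_{\pi(3)}\}$. These six sets partition $\Lambda$ up to a set of Lebesgue measure zero. The Brun algorithm is the map $F$, defined almost everywhere on $\Lambda$, which subtracts the second largest coordinate from the largest one: for $\mathbf{x}\in\Lambda_\pi$, $F(\mathbf{x})$ is obtained from $\mathbf{x}$ by replacing the coordinate $x_{\pi(3)}$ by $x_{\pi(3)}-x_{\pi(2)}$ and leaving the other coordinates unchanged (in place). Its projective version is $f:\Delta\to\Delta$, $f(\mathbf{x})=F(\mathbf{x})/\|F(\mathbf{x})\|_1$, where $\|\mathbf{x}\|_1=\sum_i|x_i|$; it is defined almost everywhere on $\Delta$. The coordinates on $\Delta$ are $(x_1,x_2)$, with $x_3=1-x_1-x_2$. *)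

theory Defs
  imports "HOL-Analysis.Analysis" "HOL-Combinatorics.Permutations"
begin

(* Coordinates are indexed by the type 3, whose elements are exactly 1, 2, 3 (UNIV_3);
   the elements of S_3 are the functions p with "p permutes (UNIV :: 3 set)". *)

definition Lambda :: "(real^3) set" where
  "Lambda = {x. x $ 1 > 0 \<and> x $ 2 > 0 \<and> x $ 3 > 0}"

definition Lambda_perm :: "(3 \<Rightarrow> 3) \<Rightarrow> (real^3) set" where
  "Lambda_perm p = {x \<in> Lambda. x $ p 1 < x $ p 2 \<and> x $ p 2 < x $ p 3}"

definition Delta :: "(real^3) set" where
  "Delta = {x. x $ 1 > 0 \<and> x $ 2 > 0 \<and> x $ 3 > 0 \<and> x $ 1 + x $ 2 + x $ 3 = 1}"

definition Lambda_ord :: "(real^3) set" where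
  "Lambda_ord = (\<Union>p\<in>{p. p permutes UNIV}. Lambda_perm p)"

(* Meaningful for x in Lambda_ord only, where p exists and is unique (ordering_eq). *)
definition ordering :: "real^3 \<Rightarrow> 3 \<Rightarrow> 3" where
  "ordering x = (THE p. p permutes UNIV \<and> x \<in> Lambda_perm p)"

(* F and f are partial maps with domains Lambda_ord and Delta \<inter> Lambda_ord.
   Their values elsewhere are irrelevant: preimages are always taken inside the domain. *)

definition brun :: "real^3 \<Rightarrow> real^3" where
  "brun x = (let p = ordering x in
     (\<chi> i. if i = p 3 then x $ p 3 - x $ p 2 else x $ i))"

definition norm1 :: "real^3 \<Rightarrow> real" where
  "norm1 x = (\<Sum>i\<in>UNIV. \<bar>x $ i\<bar>)"

definition brun_proj :: "real^3 \<Rightarrow> real^3" where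
  "brun_proj x = (1 / norm1 (brun x)) *\<^sub>R brun x"

definition brun_proj_preimage :: "(real^3) set \<Rightarrow> (real^3) set" where
  "brun_proj_preimage B = {x \<in> Delta \<inter> Lambda_ord. brun_proj x \<in> B}"

(* The value 0 is chosen on the null set where delta is not defined. *)
definition brun_density :: "real^3 \<Rightarrow> real" where
  "brun_density x = (if x \<in> Lambda_ord then
     (let p = ordering x in
        1 / (2 * x $ p 2 * (1 - x $ p 2) * (1 - x $ p 1 - x $ p 2)))
     else 0)"

definition Delta_coords :: "(real^2) set" where
  "Delta_coords = {y. y $ 1 > 0 \<and> y $ 2 > 0 \<and> y $ 1 + y $ 2 < 1}"

definition Delta_param :: "real^2 \<Rightarrow> real^3" where
  "Delta_param y = vector [y $ 1, y $ 2, 1 - y $ 1 - y $ 2]"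

(* The measure dx_1 dx_2 on the Borel sets of Delta: planar Lebesgue measure carried over
   by the coordinates (x_1, x_2), not the surface measure of the triangle. *)
definition Delta_lebesgue :: "(real^3) measure" where
  "Delta_lebesgue =
     distr (restrict_space lborel Delta_coords) (restrict_space borel Delta) Delta_param"

definition brun_measure :: "(real^3) measure" where
  "brun_measure = density Delta_lebesgue (\<lambda>x. ennreal (brun_density x))"

lemma ordering_eq:
  assumes p: "p permutes UNIV" and x: "x \<in> Lambda_perm p"
  shows "ordering x = p"
  unfolding ordering_def
proof (rule the_equality)
  show "p permutes UNIV \<and> x \<in> Lambda_perm p" using assms by simp
next
  fix q assume q: "q permutes UNIV \<and> x \<in> Lambda_perm q"
  have P: "p 1 \<noteq> p 2" "p 1 \<noteq> p 3" "p 2 \<noteq> p 3" "q 1 \<noteq> q 2" "q 1 \<noteq> q 3" "q 2 \<noteq> q 3"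
    using x q by (auto simp: Lambda_perm_def)
  have ex: "p 1 = 1 \<or> p 1 = 2 \<or> p 1 = 3" "p 2 = 1 \<or> p 2 = 2 \<or> p 2 = 3"
    "p 3 = 1 \<or> p 3 = 2 \<or> p 3 = 3" "q 1 = 1 \<or> q 1 = 2 \<or> q 1 = 3"
    "q 2 = 1 \<or> q 2 = 2 \<or> q 2 = 3" "q 3 = 1 \<or> q 3 = 2 \<or> q 3 = 3"
    by (rule exhaust_3)+
  have lt: "x $ p 1 < x $ p 2" "x $ p 2 < x $ p 3" "x $ q 1 < x $ q 2" "x $ q 2 < x $ q 3"
    using x q by (auto simp: Lambda_perm_def)
  have "q 1 = p 1 \<and> q 2 = p 2 \<and> q 3 = p 3"
    using P ex lt by (elim disjE) auto
  then show "q = p"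
    unfolding fun_eq_iff forall_3 by simp
qed

lemma Lambda_ord_iff:
  "x \<in> Lambda_ord \<longleftrightarrow> x \<in> Lambda \<and> x $ 1 \<noteq> x $ 2 \<and> x $ 1 \<noteq> x $ 3 \<and> x $ 2 \<noteq> x $ 3"
proof
  assume "x \<in> Lambda_ord"
  then obtain p where p: "p permutes UNIV" "x \<in> Lambda_perm p"
    by (auto simp: Lambda_ord_def)
  have ex: "p 1 = 1 \<or> p 1 = 2 \<or> p 1 = 3" "p 2 = 1 \<or> p 2 = 2 \<or> p 2 = 3"
    "p 3 = 1 \<or> p 3 = 2 \<or> p 3 = 3"
    by (rule exhaust_3)+
  show "x \<in> Lambda \<and> x $ 1 \<noteq> x $ 2 \<and> x $ 1 \<noteq> x $ 3 \<and> x $ 2 \<noteq> x $ 3"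
    using p(2) ex unfolding Lambda_perm_def by (elim disjE) auto
next
  assume x: "x \<in> Lambda \<and> x $ 1 \<noteq> x $ 2 \<and> x $ 1 \<noteq> x $ 3 \<and> x $ 2 \<noteq> x $ 3"
  have *: "x \<in> Lambda_ord"
    if d: "a \<noteq> b" "a \<noteq> c" "b \<noteq> c" and lt: "x $ a < x $ b" "x $ b < x $ c" for a b c :: 3
  proof -
    define p :: "3 \<Rightarrow> 3" where "p = (\<lambda>i. if i = 1 then a else if i = 2 then b else c)"
    have p: "p 1 = a" "p 2 = b" "p 3 = c" by (auto simp: p_def)
    have "inj p" unfolding inj_def forall_3 p using d by auto
    then have "bij p" by (simp add: bij_def finite_UNIV_inj_surj)
    then have "p permutes UNIV" by (intro bij_imp_permutes) auto
    moreover have "x \<in> Lambda_perm p" using x lt by (simp add: Lambda_perm_def p)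
    ultimately show ?thesis by (auto simp: Lambda_ord_def)
  qed
  show "x \<in> Lambda_ord"
    using x *[of 1 2 3] *[of 1 3 2] *[of 2 1 3] *[of 2 3 1] *[of 3 1 2] *[of 3 2 1]
    by (auto simp: neq_iff)
qed

lemma brun_proj_in_Delta:
  assumes "x \<in> Lambda_ord"
  shows "brun_proj x \<in> Delta"
proof -
  from assms obtain p where p: "p permutes UNIV" "x \<in> Lambda_perm p"
    by (auto simp: Lambda_ord_def)
  have "brun x $ 1 > 0 \<and> brun x $ 2 > 0 \<and> brun x $ 3 > 0"
    using p(2) by (auto simp: brun_def ordering_eq[OF p] Lambda_perm_def Lambda_def Let_def)
  moreover from this have "norm1 (brun x) = brun x $ 1 + brun x $ 2 + brun x $ 3"
    by (simp add: norm1_def sum_3)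
  ultimately show ?thesis
    by (simp add: brun_proj_def Delta_def flip: add_divide_distrib)
qed

lemma Delta_param_measurable:
  "Delta_param \<in> restrict_space lborel Delta_coords \<rightarrow>\<^sub>M restrict_space borel Delta"
proof (rule measurable_restrict_space3)
  have "continuous_on UNIV Delta_param"
  proof -
    have "Delta_param = (\<lambda>y. \<chi> i. if i = 1 then y $ 1 else if i = 2 then y $ 2 else 1 - y $ 1 - y $ 2)"
      by (auto simp: Delta_param_def fun_eq_iff vec_eq_iff forall_3)
    moreover have "continuous_on UNIV (\<lambda>y::real^2. (\<chi> i. if i = 1 then y $ 1 else if i = 2 then y $ 2
        else 1 - y $ 1 - y $ 2) :: real^3)"
    proof (rule continuous_on_vec_lambda)
      fix i :: 3
      show "continuous_on UNIV (\<lambda>y::real^2. if i = 1 then y $ 1 else if i = 2 then y $ 2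
          else 1 - y $ 1 - y $ 2)"
        by (cases "i = 1"; cases "i = 2") (auto intro!: continuous_intros)
    qed
    ultimately show ?thesis by (simp only:)
  qed
  then show "Delta_param \<in> lborel \<rightarrow>\<^sub>M borel"
    by (simp add: borel_measurable_continuous_onI)
  show "Delta_param \<in> Delta_coords \<rightarrow> Delta"
    by (auto simp: Delta_param_def Delta_coords_def Delta_def)
qed

lemma AE_Lambda_ord: "AE x in Delta_lebesgue. x \<in> Lambda_ord"
proof -
  have hyp: "AE y in lborel. a \<bullet> y \<noteq> b" if "a \<noteq> 0" for a :: "real^2" and b
  proof -
    have "negligible {y. a \<bullet> y = b}" using that by (simp add: negligible_hyperplane)
    then have "{y. a \<bullet> y = b} \<in> null_sets lborel"
      by (simp add: negligible_iff_null_sets null_sets_completion_iff closed_hyperplane borel_closed)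
    then show ?thesis using AE_not_in by fastforce
  qed
  have ae: "AE y::real^2 in lborel.
      y $ 1 \<noteq> y $ 2 \<and> 2 * y $ 1 + y $ 2 \<noteq> 1 \<and> y $ 1 + 2 * y $ 2 \<noteq> 1"
    using hyp[of "vector [1, -1]" 0] hyp[of "vector [2, 1]" 1] hyp[of "vector [1, 2]" 1]
    by (simp add: inner_vec_def sum_2 vec_eq_iff forall_2)
  have C: "Delta_coords \<in> sets lborel"
    by (simp add: Delta_coords_def)
  have L: "{x \<in> space (restrict_space borel Delta). x \<in> Lambda_ord} \<in> sets (restrict_space borel Delta)"
  proof -
    have "Lambda_ord \<in> sets borel"
    proof -
      have "Lambda_ord = {x. x \<in> Lambda \<and> x $ 1 \<noteq> x $ 2 \<and> x $ 1 \<noteq> x $ 3 \<and> x $ 2 \<noteq> x $ 3}"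
        by (auto simp: Lambda_ord_iff)
      also have "\<dots> \<in> sets borel" unfolding Lambda_def by simp
      finally show ?thesis .
    qed
    moreover have "{x \<in> space (restrict_space borel Delta). x \<in> Lambda_ord} = Delta \<inter> Lambda_ord"
      by (auto simp: space_restrict_space)
    ultimately show ?thesis by (auto simp: sets_restrict_space)
  qed
  have "AE y in lborel. y \<in> Delta_coords \<longrightarrow> Delta_param y \<in> Lambda_ord"
    using ae
  proof (rule eventually_mono)
    fix y :: "real^2"
    assume "y $ 1 \<noteq> y $ 2 \<and> 2 * y $ 1 + y $ 2 \<noteq> 1 \<and> y $ 1 + 2 * y $ 2 \<noteq> 1"
    then show "y \<in> Delta_coords \<longrightarrow> Delta_param y \<in> Lambda_ord"
      by (auto simp: Delta_param_def Delta_coords_def Lambda_ord_iff Lambda_def)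
  qed
  then show ?thesis
    unfolding Delta_lebesgue_def AE_distr_iff[OF Delta_param_measurable L]
    using C by (simp add: AE_restrict_space_iff)
qed

end

theory Submission
  imports Defs
begin

text \<open>
  On each sector \<open>\<Lambda>\<^sub>p\<close> the projective Brun map is injective, with inverse branch
  \<open>y \<mapsto> (y + y\<^bsub>p 2\<^esub> e\<^bsub>p 3\<^esub>) / (1 + y\<^bsub>p 2\<^esub>)\<close>, defined where \<open>y\<^bsub>p 1\<^esub> < y\<^bsub>p 2\<^esub>\<close>.
  So almost every \<open>y\<close> has exactly three preimages, one for each ordered pair of coordinates
  in increasing order, and invariance of the density \<open>\<delta>\<close> means that \<open>\<delta>(y)\<close> is the sum, over these
  three branches, of \<open>\<delta>\<close> at the preimage times the Jacobian of the branch.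

  A branch is the radial projection to the simplex of a linear map of determinant 1, which gives it
  the Jacobian \<open>(1 + y\<^bsub>p 2\<^esub>)\<^sup>-\<^sup>3\<close> (\<open>det_coord_branch_derivative\<close>). This cancels the denominators of
  \<open>\<delta>\<close> at the preimage, a function homogeneous of degree \<open>-3\<close> once \<open>1\<close> is read as the sum of the
  coordinates, and leaves \<open>1 / (2 y\<^bsub>p 2\<^esub> (y\<^bsub>p 2\<^esub> + y\<^bsub>p 3\<^esub>))\<close>
  (\<open>sector_density_inverse_branch\<close>). If \<open>a < b < c\<close> are the sorted coordinates of \<open>y\<close>, the three
  contributions are \<open>1 / (2b(b+c))\<close>, \<open>1 / (2c(b+c))\<close> and \<open>1 / (2c(a+c))\<close>. The first two add up to
  \<open>1 / (2bc)\<close>; as \<open>a + c = 1 - b\<close>, adding the third gives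
  \<open>1 / (2b(1-b)c) = \<delta>(y)\<close> (\<open>sum_branch_density\<close>).

  Integrals over \<open>\<Delta>\<close> are computed in the planar coordinates. There a branch is a scaling plus a
  rank-one perturbation divided by an affine function, so one computation of its derivative serves
  all six permutations.
\<close>

section \<open>Change of variables for nonnegative integrals\<close>

text \<open>
  The library computes the Lebesgue measure of the injective image of a set from the Jacobian.
  Applied to the part of \<open>E\<close> that \<open>g\<close> sends into \<open>A\<close>, this determines on all Borel sets the measure
  that \<open>g\<close> pushes forward from \<open>E\<close> with density \<open>J\<close>. Finiteness of the measure of \<open>g ` E\<close> is
  what makes the Jacobian integrable.
\<close>

lemma emeasure_differentiable_image_Int:
  fixes g :: "real^'n::{finite,wellorder} \<Rightarrow> real^'n::_"
  assumes E: "E \<in> sets borel" and g: "g \<in> borel_measurable borel"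
    and der: "\<And>x. x \<in> E \<Longrightarrow> (g has_derivative g' x) (at x)"
    and det: "\<And>x. x \<in> E \<Longrightarrow> \<bar>det (matrix (g' x))\<bar> = J x"
    and inj: "inj_on g E"
    and im: "g ` E \<in> sets borel" "emeasure lborel (g ` E) < \<infinity>"
    and A: "A \<in> sets borel"
  shows "emeasure lborel (A \<inter> g ` E) = (\<integral>\<^sup>+x. ennreal (J x) * indicator (g -` A \<inter> E) x \<partial>lborel)"
proof -
  define S where "S = g -` A \<inter> E"
  have S: "S \<in> sets borel"
    unfolding S_def using measurable_sets_borel[OF g A] E by auto
  have SL: "S \<in> sets lebesgue" using S by auto
  have SE: "S \<subseteq> E" by (auto simp: S_def)
  have im_S: "g ` S = A \<inter> g ` E" by (auto simp: S_def)
  have bS: "g ` S \<in> sets borel" using im A by (simp add: im_S)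
  have fin: "emeasure lborel (g ` S) < \<infinity>"
    using emeasure_mono[of "g ` S" "g ` E" lborel] im by (auto simp: im_S)
  then have lm: "g ` S \<in> lmeasurable"
    using bS by (intro fmeasurableI) (auto simp: emeasure_completion)
  have der': "\<And>x. x \<in> S \<Longrightarrow> (g has_derivative g' x) (at x within S)"
    using der SE by (meson has_derivative_at_withinI subsetD)
  have inj': "inj_on g S" using inj SE by (rule inj_on_subset)
  have intg: "(\<lambda>x. \<bar>det (matrix (g' x))\<bar>) integrable_on S"
    using measurable_differentiable_image_eq[OF SL der' inj'] lm by blast
  have "((\<lambda>x. \<bar>det (matrix (g' x))\<bar>) has_integral measure lebesgue (g ` S)) S"
    using measure_differentiable_image_eq[OF SL der' inj' intg] intg
    by (simp add: integrable_integral)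
  from nn_integral_has_integral_lebesgue'[OF _ this]
  have "(\<integral>\<^sup>+x. ennreal \<bar>det (matrix (g' x))\<bar> * indicator S x \<partial>lborel) = ennreal (measure lebesgue (g ` S))"
    by simp
  also have "\<dots> = emeasure lborel (g ` S)"
    using bS fin by (simp add: emeasure_eq_ennreal_measure)
  also have "(\<integral>\<^sup>+x. ennreal \<bar>det (matrix (g' x))\<bar> * indicator S x \<partial>lborel) =
      (\<integral>\<^sup>+x. ennreal (J x) * indicator S x \<partial>lborel)"
    using det SE by (intro nn_integral_cong) (auto split: split_indicator)
  finally show ?thesis using im_S unfolding S_def by metis
qed

text \<open>
  Equality of measures passes the formula for sets on to every nonnegative Borel function,
  so the unbounded Brun density can be handled without integrability estimates.
\<close>

lemma nn_integral_change_of_variables: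
  fixes g :: "real^'n::{finite,wellorder} \<Rightarrow> real^'n::_"
  assumes E: "E \<in> sets borel" and g: "g \<in> borel_measurable borel"
    and J: "J \<in> borel_measurable borel"
    and der: "\<And>x. x \<in> E \<Longrightarrow> (g has_derivative g' x) (at x)"
    and det: "\<And>x. x \<in> E \<Longrightarrow> \<bar>det (matrix (g' x))\<bar> = J x"
    and inj: "inj_on g E"
    and im: "g ` E \<in> sets borel" "emeasure lborel (g ` E) < \<infinity>"
    and h: "h \<in> borel_measurable borel"
  shows "(\<integral>\<^sup>+u. h u * indicator (g ` E) u \<partial>lborel) =
    (\<integral>\<^sup>+v. h (g v) * (ennreal (J v) * indicator E v) \<partial>lborel)"
proof -
  note [measurable] = E g J h im(1)
  let ?D = "density lborel (\<lambda>v. ennreal (J v) * indicator E v)"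
  have eq: "density lborel (indicator (g ` E)) = distr ?D borel g"
  proof (rule measure_eqI)
    fix A assume "A \<in> sets (density lborel (indicator (g ` E)))"
    then have A: "A \<in> sets borel" by simp
    have "emeasure (density lborel (indicator (g ` E))) A = emeasure lborel (A \<inter> g ` E)"
      using A by (simp add: emeasure_density flip: indicator_inter_arith)
        (simp add: Int_commute)
    also have "\<dots> = (\<integral>\<^sup>+x. ennreal (J x) * indicator (g -` A \<inter> E) x \<partial>lborel)"
      by (rule emeasure_differentiable_image_Int[OF E g der det inj im A])
    also have "\<dots> = (\<integral>\<^sup>+x. ennreal (J x) * indicator E x * indicator (g -` A) x \<partial>lborel)"
      by (intro nn_integral_cong) (auto split: split_indicator)
    also have "\<dots> = emeasure (distr ?D borel g) A"
      using A measurable_sets_borel[OF g A] by (simp add: emeasure_distr emeasure_density)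
    finally show "emeasure (density lborel (indicator (g ` E))) A = emeasure (distr ?D borel g) A" .
  qed simp
  have "(\<integral>\<^sup>+u. h u * indicator (g ` E) u \<partial>lborel) = integral\<^sup>N (density lborel (indicator (g ` E))) h"
    by (simp add: nn_integral_density mult.commute)
  also have "\<dots> = (\<integral>\<^sup>+v. h (g v) * (ennreal (J v) * indicator E v) \<partial>lborel)"
    by (simp add: eq nn_integral_distr nn_integral_density mult.commute)
  finally show ?thesis .
qed

section \<open>Permutations of the three coordinates\<close>

lemma sum_permutations_3:
  "(\<Sum>p | p permutes (UNIV :: 3 set). g (p 1) (p 2) (p 3)) =
    g 1 2 3 + g 1 3 2 + g 2 1 3 + g 2 3 1 + g 3 1 2 + (g 3 2 1 :: 'a :: comm_monoid_add)"
proof -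
  have fin: "finite {2::3, 3}" "finite {3::3}" by auto
  have notin: "1 \<notin> {2::3, 3}" "2 \<notin> {3::3}" by auto
  show ?thesis
    unfolding UNIV_3 sum_over_permutations_insert[OF fin(1) notin(1)]
      sum_over_permutations_insert[OF fin(2) notin(2)] permutes_sing
    by (simp add: transpose_def ac_simps)
qed

context
  fixes p :: "3 \<Rightarrow> 3"
  assumes p: "p permutes UNIV"
begin

lemma permuted_coord_eq_iff [simp]: "p i = p j \<longleftrightarrow> i = j"
  using permutes_inj[OF p] by (simp add: inj_eq)

lemma forall_3_permuted: "(\<forall>i. P i) \<longleftrightarrow> P (p 1) \<and> P (p 2) \<and> P (p 3)"
  using permutes_surj[OF p] unfolding forall_3[of "\<lambda>i. P (p i)", symmetric]
  by (metis surjD)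

lemma sum_3_permuted: "(\<Sum>i\<in>UNIV. (h i :: 'a :: comm_monoid_add)) = h (p 1) + h (p 2) + h (p 3)"
proof -
  have "(\<Sum>i\<in>UNIV. h i) = (\<Sum>i\<in>UNIV. h (p i))"
    using sum.permute[OF p, of h] by (simp add: comp_def)
  then show ?thesis by (simp add: sum_3)
qed

lemma Delta_permuted_iff:
  "x \<in> Delta \<longleftrightarrow> x $ p 1 > 0 \<and> x $ p 2 > 0 \<and> x $ p 3 > 0 \<and> x $ p 1 + x $ p 2 + x $ p 3 = 1"
  using forall_3_permuted[of "\<lambda>i. x $ i > 0"] sum_3_permuted[of "\<lambda>i. x $ i"]
  by (auto simp: Delta_def forall_3 sum_3)

lemma Lambda_perm_Delta_iff:
  "x \<in> Delta \<inter> Lambda_perm p \<longleftrightarrow> x \<in> Delta \<and> x $ p 1 < x $ p 2 \<and> x $ p 2 < x $ p 3"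
  by (auto simp: Lambda_perm_def Delta_def Lambda_def)

end

section \<open>The inverse branches of the algorithm\<close>

text \<open>
  The next two functions are the closed formulas for the Brun map and for its density that hold on
  the sector of \<open>p\<close>. Unlike the originals they involve no choice of a permutation, so they are
  visibly Borel on the whole space.
\<close>

definition sector_map :: "(3 \<Rightarrow> 3) \<Rightarrow> real^3 \<Rightarrow> real^3" where
  "sector_map p x = (1 / (1 - x $ p 2)) *\<^sub>R (x - x $ p 2 *\<^sub>R axis (p 3) 1)"

definition sector_density :: "(3 \<Rightarrow> 3) \<Rightarrow> real^3 \<Rightarrow> real" where
  "sector_density p x = 1 / (2 * x $ p 2 * (1 - x $ p 2) * (1 - x $ p 1 - x $ p 2))"

definition inverse_branch :: "(3 \<Rightarrow> 3) \<Rightarrow> real^3 \<Rightarrow> real^3" where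
  "inverse_branch p y = (1 / (1 + y $ p 2)) *\<^sub>R (y + y $ p 2 *\<^sub>R axis (p 3) 1)"

definition branch_domain :: "(3 \<Rightarrow> 3) \<Rightarrow> (real^3) set" where
  "branch_domain p = {y \<in> Delta. y $ p 1 < y $ p 2}"

text \<open>The density at the preimage times the Jacobian of the branch, after cancellation.\<close>

definition branch_density :: "(3 \<Rightarrow> 3) \<Rightarrow> real^3 \<Rightarrow> real" where
  "branch_density p y = 1 / (2 * y $ p 2 * (y $ p 2 + y $ p 3))"

lemma sector_map_borel: "sector_map p \<in> borel_measurable borel"
  unfolding sector_map_def by measurable

lemma sector_density_borel: "sector_density p \<in> borel_measurable borel"
  unfolding sector_density_def by measurable

lemma inverse_branch_borel: "inverse_branch p \<in> borel_measurable borel"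
  unfolding inverse_branch_def by measurable

lemma Delta_borel: "Delta \<in> sets borel"
  unfolding Delta_def by measurable

lemma Lambda_perm_borel: "Lambda_perm p \<in> sets borel"
  unfolding Lambda_perm_def Lambda_def by measurable

lemma branch_domain_borel: "branch_domain p \<in> sets borel"
proof -
  have "{y::real^3. y $ p 1 < y $ p 2} \<in> sets borel" by measurable
  moreover have "branch_domain p = Delta \<inter> {y. y $ p 1 < y $ p 2}"
    by (auto simp: branch_domain_def)
  ultimately show ?thesis using Delta_borel by auto
qed

context
  fixes p :: "3 \<Rightarrow> 3"
  assumes p: "p permutes UNIV"
begin

lemmas [simp] = permuted_coord_eq_iff[OF p]

lemma inverse_branch_nth:
  "inverse_branch p y $ p 1 = y $ p 1 / (1 + y $ p 2)"
  "inverse_branch p y $ p 2 = y $ p 2 / (1 + y $ p 2)"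
  "inverse_branch p y $ p 3 = (y $ p 2 + y $ p 3) / (1 + y $ p 2)"
  by (simp_all add: inverse_branch_def axis_def add_ac)

lemma sector_map_nth:
  "sector_map p x $ p 1 = x $ p 1 / (1 - x $ p 2)"
  "sector_map p x $ p 2 = x $ p 2 / (1 - x $ p 2)"
  "sector_map p x $ p 3 = (x $ p 3 - x $ p 2) / (1 - x $ p 2)"
  by (simp_all add: sector_map_def axis_def)

lemma brun_proj_eq_sector_map:
  assumes x: "x \<in> Delta \<inter> Lambda_perm p"
  shows "brun_proj x = sector_map p x"
proof -
  have pos: "x $ p 1 > 0" "x $ p 2 > 0" "x $ p 2 < x $ p 3"
    and sum: "x $ p 1 + x $ p 2 + x $ p 3 = 1"
    using x Lambda_perm_Delta_iff[OF p] Delta_permuted_iff[OF p] by auto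
  have ord: "ordering x = p" using ordering_eq[OF p] x by auto
  have brun: "brun x = x - x $ p 2 *\<^sub>R axis (p 3) 1"
    by (auto simp: vec_eq_iff brun_def ord Let_def axis_def)
  have "norm1 (brun x) = 1 - x $ p 2"
    unfolding norm1_def sum_3_permuted[OF p] using pos sum by (simp add: brun axis_def)
  then show ?thesis by (simp add: brun_proj_def sector_map_def brun)
qed

lemma brun_density_eq_sector_density:
  assumes "x \<in> Lambda_perm p"
  shows "brun_density x = sector_density p x"
  using assms p ordering_eq[OF p]
  by (auto simp: brun_density_def sector_density_def Lambda_ord_def Let_def)

lemma inverse_branch_in_sector:
  assumes "y \<in> branch_domain p"
  shows "inverse_branch p y \<in> Delta \<inter> Lambda_perm p"
  using assms unfolding Lambda_perm_Delta_iff[OF p] Delta_permuted_iff[OF p] branch_domain_def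
  by (auto simp: inverse_branch_nth Delta_permuted_iff[OF p] divide_strict_right_mono
        simp flip: add_divide_distrib)

lemma sector_map_inverse_branch:
  assumes "y \<in> branch_domain p"
  shows "sector_map p (inverse_branch p y) = y"
proof -
  have "1 + y $ p 2 > 0" using assms by (auto simp: branch_domain_def Delta_permuted_iff[OF p])
  moreover from this have "1 - y $ p 2 / (1 + y $ p 2) = 1 / (1 + y $ p 2)" by (simp add: field_simps)
  ultimately show ?thesis
    unfolding vec_eq_iff forall_3_permuted[OF p] sector_map_nth inverse_branch_nth
    by (simp flip: diff_divide_distrib)
qed

lemma sector_map_in_branch_domain:
  assumes "x \<in> Delta \<inter> Lambda_perm p"
  shows "sector_map p x \<in> branch_domain p"
proof -
  have pos: "x $ p 1 > 0" "x $ p 1 < x $ p 2" "x $ p 2 < x $ p 3"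
    and sum: "x $ p 1 + x $ p 2 + x $ p 3 = 1"
    using assms Lambda_perm_Delta_iff[OF p] Delta_permuted_iff[OF p] by auto
  then have "1 - x $ p 2 > 0" by linarith
  with pos sum show ?thesis
    unfolding branch_domain_def mem_Collect_eq Delta_permuted_iff[OF p] sector_map_nth
    by (auto simp: divide_strict_right_mono simp flip: add_divide_distrib)
qed

lemma inverse_branch_sector_map:
  assumes "x \<in> Delta \<inter> Lambda_perm p"
  shows "inverse_branch p (sector_map p x) = x"
proof -
  have pos: "x $ p 1 > 0" "x $ p 1 < x $ p 2" "x $ p 2 < x $ p 3"
    and sum: "x $ p 1 + x $ p 2 + x $ p 3 = 1"
    using assms Lambda_perm_Delta_iff[OF p] Delta_permuted_iff[OF p] by auto
  then have nz: "1 - x $ p 2 > 0" by linarith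
  then have "1 + x $ p 2 / (1 - x $ p 2) = 1 / (1 - x $ p 2)" by (simp add: field_simps)
  with nz show ?thesis
    unfolding vec_eq_iff forall_3_permuted[OF p] inverse_branch_nth sector_map_nth
    by (simp flip: add_divide_distrib)
qed

text \<open>
  At the preimage each of the three factors of the density has denominator \<open>1 + y\<^bsub>p 2\<^esub>\<close>,
  so the Jacobian cancels them all.
\<close>

lemma sector_density_inverse_branch:
  assumes "y \<in> branch_domain p"
  shows "sector_density p (inverse_branch p y) * (1 / (1 + y $ p 2) ^ 3) = branch_density p y"
proof -
  have pos: "y $ p 1 > 0" "y $ p 2 > 0" "y $ p 3 > 0" "y $ p 1 + y $ p 2 + y $ p 3 = 1"
    using assms by (auto simp: branch_domain_def Delta_permuted_iff[OF p])
  define d where "d = 1 + y $ p 2"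
  have d: "d > 0" using pos by (simp add: d_def)
  have 1: "1 - y $ p 2 / d = 1 / d" using d by (simp add: d_def field_simps)
  have 2: "1 - y $ p 1 / d - y $ p 2 / d = (y $ p 2 + y $ p 3) / d"
  proof -
    have "y $ p 2 + y $ p 3 = d - y $ p 1 - y $ p 2" using pos by (simp add: d_def)
    with d show ?thesis unfolding \<open>y $ p 2 + y $ p 3 = d - y $ p 1 - y $ p 2\<close>
      by (simp only: diff_divide_distrib) simp
  qed
  have "y $ p 2 + y $ p 3 > 0" using pos by simp
  then show ?thesis
    unfolding sector_density_def branch_density_def inverse_branch_nth d_def[symmetric] 1 2
    using d pos(2) by (simp add: field_simps power3_eq_cube)
qed

end

text \<open>
  The functional equation behind invariance. Only three of the six summands are nonzero; after
  composing with the permutation that sorts \<open>y\<close> they are the ones for which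
  \<open>(y\<^bsub>p 1\<^esub>, y\<^bsub>p 2\<^esub>, y\<^bsub>p 3\<^esub>)\<close> is \<open>(a, b, c)\<close>, \<open>(a, c, b)\<close> or \<open>(b, c, a)\<close>, and partial fractions collapse them.
\<close>

lemma sum_branch_density:
  assumes y: "y \<in> Delta \<inter> Lambda_ord"
  shows "(\<Sum>p | p permutes UNIV. branch_density p y * indicator (branch_domain p) y) = brun_density y"
proof -
  obtain q where q: "q permutes UNIV" "y \<in> Lambda_perm q"
    using y by (auto simp: Lambda_ord_def)
  define a b c where "a = y $ q 1" and "b = y $ q 2" and "c = y $ q 3"
  have abc: "0 < a" "a < b" "b < c" "a + b + c = 1"
    using y q Lambda_perm_Delta_iff[OF q(1)] Delta_permuted_iff[OF q(1)]
    by (auto simp: a_def b_def c_def)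
  define g where "g i j k = (if y $ q i < y $ q j then 1 / (2 * y $ q j * (y $ q j + y $ q k)) else 0)"
    for i j k
  have "(\<Sum>p | p permutes UNIV. branch_density p y * indicator (branch_domain p) y) =
      (\<Sum>p | p permutes UNIV. branch_density (q \<circ> p) y * indicator (branch_domain (q \<circ> p)) y)"
    by (rule setum_permutations_compose_left[OF q(1)])
  also have "\<dots> = (\<Sum>p | p permutes (UNIV :: 3 set). g (p 1) (p 2) (p 3))"
    using y by (intro sum.cong) (auto simp: g_def branch_density_def branch_domain_def)
  also have "\<dots> = 1 / (2 * b * (b + c)) + 1 / (2 * c * (c + b)) + 1 / (2 * c * (c + a))"
    unfolding sum_permutations_3 using abc by (simp add: g_def flip: a_def b_def c_def)
  also have "1 / (2 * b * (b + c)) + 1 / (2 * c * (c + b)) = 1 / (2 * b * c)"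
    using abc by (simp add: divide_simps) (simp only: ring_distribs mult.commute ac_simps)
  also have "c + a = 1 - b" using abc by simp
  also have "1 / (2 * b * c) + 1 / (2 * c * (1 - b)) = 1 / (2 * b * (1 - b) * c)"
    using abc by (simp add: divide_simps)
  also have "c = 1 - a - b" using abc by simp
  also have "1 / (2 * b * (1 - b) * (1 - a - b)) = brun_density y"
    using brun_density_eq_sector_density[OF q] by (simp add: sector_density_def a_def b_def)
  finally show ?thesis .
qed

section \<open>The inverse branches in the coordinates of the simplex\<close>

definition Delta_proj :: "real^3 \<Rightarrow> real^2" where
  "Delta_proj x = vector [x $ 1, x $ 2]"

lemma Delta_proj_param [simp]: "Delta_proj (Delta_param u) = u"
  by (simp add: Delta_proj_def Delta_param_def vec_eq_iff forall_2)

text \<open>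
  This needs the plane of coordinate sum 1 rather than the open simplex, since it is applied to the
  vertices when the Jacobian is computed.
\<close>

lemma Delta_param_proj: "(\<Sum>i\<in>UNIV. x $ i) = 1 \<Longrightarrow> Delta_param (Delta_proj x) = x"
  by (auto simp: Delta_proj_def Delta_param_def vec_eq_iff forall_3 sum_3)

lemma Delta_param_proj_Delta: "x \<in> Delta \<Longrightarrow> Delta_param (Delta_proj x) = x"
  by (rule Delta_param_proj) (simp add: Delta_def sum_3)

lemma linear_Delta_proj: "linear Delta_proj"
  by (rule linearI) (simp_all add: Delta_proj_def vec_eq_iff forall_2)

lemma Delta_param_in_Delta_iff: "Delta_param u \<in> Delta \<longleftrightarrow> u \<in> Delta_coords"
  by (auto simp: Delta_param_def Delta_def Delta_coords_def)

lemma Delta_param_borel: "Delta_param \<in> borel_measurable borel"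
proof -
  have *: "(\<lambda>u. Delta_param u $ i) \<in> borel_measurable borel" for i
    using exhaust_3[of i] by (auto simp: Delta_param_def)
  show ?thesis
    unfolding borel_measurable_euclidean_space[of Delta_param]
    by (auto simp: Basis_vec_def inner_axis *)
qed

lemma Delta_proj_borel: "Delta_proj \<in> borel_measurable borel"
  using linear_Delta_proj
  by (intro borel_measurable_continuous_onI linear_continuous_on) (simp add: linear_conv_bounded_linear)

lemma emeasure_Delta_coords_finite: "emeasure lborel Delta_coords < \<infinity>"
proof -
  have "Delta_coords \<subseteq> cbox 0 1"
    by (auto simp: Delta_coords_def mem_box_cart forall_2)
  then have "bounded Delta_coords" using bounded_cbox bounded_subset by blast
  then show ?thesis by (rule emeasure_bounded_finite)
qed

text \<open>
  Each barycentric coordinate is an affine function on the plane; its derivative is its linear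
  part, which for the third coordinate is \<open>h \<mapsto> - h\<^sub>1 - h\<^sub>2\<close>.
\<close>

definition coord_differential :: "3 \<Rightarrow> real^2 \<Rightarrow> real" where
  "coord_differential j h = Delta_param h $ j - Delta_param 0 $ j"

lemma coord_differential_simps:
  "coord_differential 1 h = h $ 1" "coord_differential 2 h = h $ 2"
  "coord_differential 3 h = - h $ 1 - h $ 2"
  by (simp_all add: coord_differential_def Delta_param_def)

lemma linear_coord_differential: "linear (coord_differential j)"
  using exhaust_3[of j] by (auto intro!: linearI simp: coord_differential_simps algebra_simps)

lemma has_derivative_Delta_param_nth:
  "((\<lambda>u. Delta_param u $ j) has_derivative coord_differential j) (at u)"
proof -
  have "(coord_differential j has_derivative coord_differential j) (at u)"
    using linear_coord_differential
    by (intro bounded_linear_imp_has_derivative) (simp add: linear_conv_bounded_linear)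
  then have "((\<lambda>u. coord_differential j u + Delta_param 0 $ j) has_derivative coord_differential j) (at u)"
    by (rule has_derivative_add_const)
  then show ?thesis by (simp add: coord_differential_def[of j, abs_def])
qed

text \<open>The planar case of the matrix determinant lemma.\<close>

lemma det_scale_plus_rank_one:
  fixes w :: "real^2"
  assumes "linear l"
  shows "det (matrix (\<lambda>h. a *\<^sub>R h + l h *\<^sub>R w)) = a * (a + l w)"
proof -
  have "w = w $ 1 *\<^sub>R axis 1 1 + w $ 2 *\<^sub>R axis 2 1"
    by (simp add: vec_eq_iff forall_2 axis_def)
  then have "l w = w $ 1 * l (axis 1 1) + w $ 2 * l (axis 2 1)"
    using linear_add[OF assms] linear_scale[OF assms] by (metis real_scaleR_def)
  then show ?thesis
    by (simp add: det_2 matrix_def axis_def algebra_simps)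
qed

definition coord_branch :: "(3 \<Rightarrow> 3) \<Rightarrow> real^2 \<Rightarrow> real^2" where
  "coord_branch p v = Delta_proj (inverse_branch p (Delta_param v))"

definition coord_branch_derivative :: "(3 \<Rightarrow> 3) \<Rightarrow> real^2 \<Rightarrow> real^2 \<Rightarrow> real^2" where
  "coord_branch_derivative p v h = (let z = Delta_param v $ p 2 in
    (1 / (1 + z)) *\<^sub>R h +
      coord_differential (p 2) h *\<^sub>R ((1 / (1 + z) ^ 2) *\<^sub>R (Delta_proj (axis (p 3) 1) - v)))"

lemma coord_branch_eq:
  "coord_branch p v = (1 / (1 + Delta_param v $ p 2)) *\<^sub>R
     (v + Delta_param v $ p 2 *\<^sub>R Delta_proj (axis (p 3) 1))"
  using linear_Delta_proj
  by (simp add: coord_branch_def inverse_branch_def linear_add linear_scale)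

lemma has_derivative_coord_branch:
  assumes "1 + Delta_param v $ p 2 > 0"
  shows "(coord_branch p has_derivative coord_branch_derivative p v) (at v)"
proof -
  let ?z = "\<lambda>u. Delta_param u $ p 2" and ?e = "Delta_proj (axis (p 3) 1)"
  have nz: "1 + ?z v \<noteq> 0" using assms by simp
  have "((\<lambda>u. inverse (1 + ?z u) *\<^sub>R (u + ?z u *\<^sub>R ?e)) has_derivative
      (\<lambda>h. inverse (1 + ?z v) *\<^sub>R (h + coord_differential (p 2) h *\<^sub>R ?e) +
        (- (inverse (1 + ?z v) * coord_differential (p 2) h * inverse (1 + ?z v))) *\<^sub>R (v + ?z v *\<^sub>R ?e))) (at v)"
    using nz by (auto intro!: derivative_eq_intros has_derivative_Delta_param_nth)
  moreover have "inverse (1 + ?z v) *\<^sub>R (h + coord_differential (p 2) h *\<^sub>R ?e) +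
        (- (inverse (1 + ?z v) * coord_differential (p 2) h * inverse (1 + ?z v))) *\<^sub>R (v + ?z v *\<^sub>R ?e)
      = coord_branch_derivative p v h" for h
    using nz unfolding coord_branch_derivative_def Let_def vec_eq_iff
    by (auto simp: divide_simps power2_eq_square) (simp_all add: algebra_simps)
  ultimately show ?thesis
    unfolding coord_branch_eq[abs_def] by (simp add: divide_inverse)
qed

text \<open>
  The coordinate \<open>z = y\<^bsub>p 2\<^esub>\<close> vanishes at the vertex \<open>e\<^bsub>p 3\<^esub>\<close>, so its differential takes the value
  \<open>-z\<close> on the displacement from \<open>v\<close> to that vertex. This is the one place where the position of
  the vertex enters, and it makes the determinant the same for every \<open>p\<close>.
\<close>

lemma det_coord_branch_derivative:
  assumes p: "p permutes UNIV" and pos: "1 + Delta_param v $ p 2 > 0"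
  shows "det (matrix (coord_branch_derivative p v)) = 1 / (1 + Delta_param v $ p 2) ^ 3"
proof -
  define z where "z = Delta_param v $ p 2"
  have z: "1 + z > 0" using pos by (simp add: z_def)
  let ?e = "Delta_proj (axis (p 3) 1)"
  let ?l = "coord_differential (p 2)"
  have "Delta_param ?e = axis (p 3) 1"
    by (rule Delta_param_proj) (simp add: axis_def)
  then have "?l ?e = - Delta_param 0 $ p 2"
    by (simp add: coord_differential_def axis_def permuted_coord_eq_iff[OF p])
  then have "?l (?e - v) = - z"
    by (simp add: linear_diff[OF linear_coord_differential]) (simp add: coord_differential_def z_def)
  then have l: "?l ((1 / (1 + z) ^ 2) *\<^sub>R (?e - v)) = - z / (1 + z) ^ 2"
    by (simp add: linear_scale[OF linear_coord_differential])
  have "det (matrix (coord_branch_derivative p v)) = 1 / (1 + z) * (1 / (1 + z) + - z / (1 + z) ^ 2)"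
    unfolding coord_branch_derivative_def[abs_def] Let_def z_def[symmetric]
      det_scale_plus_rank_one[OF linear_coord_differential] l ..
  also have "\<dots> = 1 / (1 + z) ^ 3"
    using z by (simp add: divide_simps) (simp add: algebra_simps power2_eq_square power3_eq_cube)
  finally show ?thesis by (simp add: z_def)
qed

text \<open>
  The part of \<open>\<mu>(f\<^sup>-\<^sup>1 B)\<close> that lies in one sector, rewritten as an integral over the image point
  \<open>y = f x\<close> in place of \<open>x\<close>.
\<close>

lemma nn_integral_sector:
  assumes p: "p permutes UNIV" and B: "B \<in> sets borel"
  shows "(\<integral>\<^sup>+u. ennreal (sector_density p (Delta_param u)) * indicator B (sector_map p (Delta_param u)) *
      indicator (Delta \<inter> Lambda_perm p) (Delta_param u) \<partial>lborel) =
    (\<integral>\<^sup>+v. ennreal (branch_density p (Delta_param v) * indicator (branch_domain p) (Delta_param v)) *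
      indicator B (Delta_param v) \<partial>lborel)"
    (is "?L = ?R")
proof -
  note [measurable] = Delta_param_borel sector_map_borel sector_density_borel B
    inverse_branch_borel Delta_proj_borel
  have [measurable]: "(\<lambda>v. Delta_param v $ p 2) \<in> borel_measurable borel"
    by (rule measurable_compose[OF Delta_param_borel]) measurable
  define E where "E = Delta_param -` branch_domain p"
  define h where "h u = ennreal (sector_density p (Delta_param u)) * indicator B (sector_map p (Delta_param u))" for u
  define J where "J v = 1 / (1 + Delta_param v $ p 2) ^ 3" for v
  have dom: "Delta_param v \<in> branch_domain p" if "v \<in> E" for v using that by (simp add: E_def)
  have pos: "Delta_param v $ p 2 > 0" if "v \<in> E" for v
    using dom[OF that] by (auto simp: branch_domain_def Delta_permuted_iff[OF p])
  have param_branch: "Delta_param (coord_branch p v) = inverse_branch p (Delta_param v)" if "v \<in> E" for v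
    unfolding coord_branch_def using inverse_branch_in_sector[OF p dom[OF that]]
    by (auto intro: Delta_param_proj_Delta)
  have inj: "inj_on (coord_branch p) E"
  proof (rule inj_onI)
    fix v w assume vw: "v \<in> E" "w \<in> E" "coord_branch p v = coord_branch p w"
    then have "Delta_param v = Delta_param w"
      by (metis param_branch sector_map_inverse_branch[OF p] dom)
    then show "v = w" by (metis Delta_proj_param)
  qed
  have image: "coord_branch p ` E = Delta_param -` (Delta \<inter> Lambda_perm p)"
  proof (intro equalityI subsetI)
    fix u assume "u \<in> coord_branch p ` E"
    then show "u \<in> Delta_param -` (Delta \<inter> Lambda_perm p)"
      using param_branch inverse_branch_in_sector[OF p dom] by force
  next
    fix u assume u: "u \<in> Delta_param -` (Delta \<inter> Lambda_perm p)"
    let ?v = "Delta_proj (sector_map p (Delta_param u))"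
    have dom': "sector_map p (Delta_param u) \<in> branch_domain p"
      using u by (intro sector_map_in_branch_domain[OF p]) simp
    then have eq: "Delta_param ?v = sector_map p (Delta_param u)"
      by (intro Delta_param_proj_Delta) (simp add: branch_domain_def)
    have "coord_branch p ?v = u"
      unfolding coord_branch_def eq using u by (subst inverse_branch_sector_map[OF p]) auto
    moreover have "?v \<in> E" using dom' eq by (simp add: E_def)
    ultimately show "u \<in> coord_branch p ` E" by (metis image_eqI)
  qed
  have "?L = (\<integral>\<^sup>+u. h u * indicator (coord_branch p ` E) u \<partial>lborel)"
    unfolding image h_def by (simp add: indicator_def)
  also have "\<dots> = (\<integral>\<^sup>+v. h (coord_branch p v) * (ennreal (J v) * indicator E v) \<partial>lborel)"
  proof (rule nn_integral_change_of_variables)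
    show "E \<in> sets borel"
      unfolding E_def by (rule measurable_sets_borel[OF Delta_param_borel branch_domain_borel])
    show "coord_branch p \<in> borel_measurable borel" unfolding coord_branch_def by measurable
    show "J \<in> borel_measurable borel" unfolding J_def by measurable
    show "h \<in> borel_measurable borel" unfolding h_def by measurable
    show "(coord_branch p has_derivative coord_branch_derivative p v) (at v)" if "v \<in> E" for v
      using pos[OF that] by (intro has_derivative_coord_branch) simp
    show "\<bar>det (matrix (coord_branch_derivative p v))\<bar> = J v" if "v \<in> E" for v
      using pos[OF that] by (simp add: det_coord_branch_derivative[OF p] J_def)
    show "inj_on (coord_branch p) E" by (rule inj)
    show "coord_branch p ` E \<in> sets borel"
      unfolding image using Delta_borel Lambda_perm_borel
      by (intro measurable_sets_borel[OF Delta_param_borel]) auto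
    have "coord_branch p ` E \<subseteq> Delta_coords"
      unfolding image by (auto simp: Delta_param_in_Delta_iff)
    moreover have "Delta_coords \<in> sets lborel" by (simp add: Delta_coords_def)
    ultimately show "emeasure lborel (coord_branch p ` E) < \<infinity>"
      using emeasure_mono[of "coord_branch p ` E" Delta_coords lborel] emeasure_Delta_coords_finite
      by (metis order.strict_trans1)
  qed
  also have "\<dots> = ?R"
  proof (intro nn_integral_cong)
    fix v
    show "h (coord_branch p v) * (ennreal (J v) * indicator E v) =
      ennreal (branch_density p (Delta_param v) * indicator (branch_domain p) (Delta_param v)) *
      indicator B (Delta_param v)"
    proof (cases "v \<in> E")
      case True
      have "ennreal (sector_density p (inverse_branch p (Delta_param v))) * ennreal (J v) =
          ennreal (branch_density p (Delta_param v))"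
        using pos[OF True] sector_density_inverse_branch[OF p dom[OF True]]
        by (simp add: J_def flip: ennreal_mult'')
      then show ?thesis
        using True dom[OF True]
        by (simp add: h_def param_branch sector_map_inverse_branch[OF p] mult_ac split: split_indicator)
    qed (simp add: E_def)
  qed
  finally show ?thesis .
qed

section \<open>Invariance of the Brun measure\<close>

lemma brun_density_eq_sum:
  "brun_density x = (\<Sum>p | p permutes UNIV. sector_density p x * indicator (Lambda_perm p) x)"
proof (cases "x \<in> Lambda_ord")
  case True
  then obtain q where q: "q permutes UNIV" "x \<in> Lambda_perm q"
    by (auto simp: Lambda_ord_def)
  have "(\<Sum>p | p permutes UNIV. sector_density p x * indicator (Lambda_perm p) x) =
      (\<Sum>p | p permutes UNIV. if p = q then sector_density q x else 0)"
    using q ordering_eq by (intro sum.cong) (auto simp: indicator_def)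
  also have "\<dots> = sector_density q x"
    using q by (simp add: finite_permutations)
  finally show ?thesis using brun_density_eq_sector_density[OF q] by simp
next
  case False
  then have "\<And>p. p permutes UNIV \<Longrightarrow> x \<notin> Lambda_perm p" by (auto simp: Lambda_ord_def)
  with False show ?thesis by (simp add: brun_density_def)
qed

lemma brun_density_borel: "brun_density \<in> borel_measurable borel"
proof -
  note [measurable] = sector_density_borel Lambda_perm_borel
  show ?thesis unfolding brun_density_eq_sum[abs_def] by measurable
qed

lemma brun_density_borel_Delta: "brun_density \<in> borel_measurable Delta_lebesgue"
proof -
  have "brun_density \<in> borel_measurable (restrict_space borel Delta)"
    using brun_density_borel by (rule measurable_restrict_space1)
  then show ?thesis by (simp add: Delta_lebesgue_def)
qed

lemma brun_proj_preimage_eq_UN: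
  "brun_proj_preimage B = (\<Union>p\<in>{p. p permutes UNIV}. Delta \<inter> Lambda_perm p \<inter> sector_map p -` B)"
  unfolding brun_proj_preimage_def Lambda_ord_def
  by (auto simp: brun_proj_eq_sector_map)

lemma brun_proj_preimage_borel:
  assumes "B \<in> sets borel"
  shows "brun_proj_preimage B \<in> sets borel"
  unfolding brun_proj_preimage_eq_UN
  using measurable_sets_borel[OF sector_map_borel assms] Delta_borel Lambda_perm_borel
  by (intro sets.finite_UN) (auto simp: finite_permutations)

text \<open>
  The integral extends over the whole plane, without the indicator of the planar triangle: points
  outside the triangle are parametrised outside \<open>Delta\<close>, hence outside \<open>A\<close>.
\<close>

lemma emeasure_brun_measure:
  assumes A: "A \<in> sets borel" "A \<subseteq> Delta"
  shows "emeasure brun_measure A =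
    (\<integral>\<^sup>+u. ennreal (brun_density (Delta_param u)) * indicator A (Delta_param u) \<partial>lborel)"
proof -
  note [measurable] = Delta_param_measurable
  have A': "A \<in> sets (restrict_space borel Delta)"
    using A by (auto simp: sets_restrict_space)
  have C: "Delta_coords \<in> sets borel" by (simp add: Delta_coords_def)
  have m: "(\<lambda>x. ennreal (brun_density x) * indicator A x) \<in> borel_measurable (restrict_space borel Delta)"
    using brun_density_borel A by (intro measurable_restrict_space1) auto
  have "emeasure brun_measure A =
      (\<integral>\<^sup>+x. ennreal (brun_density x) * indicator A x \<partial>Delta_lebesgue)"
    unfolding brun_measure_def using brun_density_borel_Delta A'
    by (intro emeasure_density) (auto simp: Delta_lebesgue_def)
  also have "\<dots> = (\<integral>\<^sup>+u. ennreal (brun_density (Delta_param u)) * indicator A (Delta_param u)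
      \<partial>restrict_space lborel Delta_coords)"
    unfolding Delta_lebesgue_def by (rule nn_integral_distr[OF Delta_param_measurable]) (simp add: m)
  also have "\<dots> = (\<integral>\<^sup>+u. ennreal (brun_density (Delta_param u)) * indicator A (Delta_param u) *
      indicator Delta_coords u \<partial>lborel)"
    using C by (intro nn_integral_restrict_space) simp
  also have "\<dots> = (\<integral>\<^sup>+u. ennreal (brun_density (Delta_param u)) * indicator A (Delta_param u) \<partial>lborel)"
    using A(2) by (intro nn_integral_cong)
      (auto split: split_indicator simp flip: Delta_param_in_Delta_iff)
  finally show ?thesis .
qed

lemma AE_Delta_param_Lambda_ord: "AE u in lborel. u \<in> Delta_coords \<longrightarrow> Delta_param u \<in> Lambda_ord"
proof -
  have C: "Delta_coords \<in> sets borel" by (simp add: Delta_coords_def)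
  have "AE u in restrict_space lborel Delta_coords. Delta_param u \<in> Lambda_ord"
    using AE_Lambda_ord unfolding Delta_lebesgue_def
    by (rule AE_distrD[OF Delta_param_measurable])
  then show ?thesis using C by (simp add: AE_restrict_space_iff)
qed

lemma branch_density_nonneg: "y \<in> Delta \<Longrightarrow> p permutes UNIV \<Longrightarrow> branch_density p y \<ge> 0"
  by (auto simp: branch_density_def Delta_permuted_iff)

lemma brun_density_preimage_eq_sum:
  "ennreal (brun_density x) * indicator (brun_proj_preimage B) x =
    (\<Sum>p | p permutes UNIV. ennreal (sector_density p x) * indicator B (sector_map p x) *
      indicator (Delta \<inter> Lambda_perm p) x)"
proof (cases "x \<in> Delta \<inter> Lambda_ord")
  case True
  then obtain q where q: "q permutes UNIV" "x \<in> Delta \<inter> Lambda_perm q"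
    by (auto simp: Lambda_ord_def)
  have "(\<Sum>p | p permutes UNIV. ennreal (sector_density p x) * indicator B (sector_map p x) *
      indicator (Delta \<inter> Lambda_perm p) x) =
      (\<Sum>p | p permutes UNIV. if p = q then ennreal (sector_density q x) * indicator B (sector_map q x) else 0)"
    using q ordering_eq by (intro sum.cong) (auto simp: indicator_def)
  also have "\<dots> = ennreal (sector_density q x) * indicator B (sector_map q x)"
    using q by (simp add: finite_permutations)
  also have "\<dots> = ennreal (brun_density x) * indicator (brun_proj_preimage B) x"
    using q True brun_density_eq_sector_density[of q x] brun_proj_eq_sector_map[of q x]
    by (simp add: brun_proj_preimage_def indicator_def)
  finally show ?thesis ..
next
  case False
  then have "\<And>p. p permutes UNIV \<Longrightarrow> x \<notin> Delta \<inter> Lambda_perm p" "x \<notin> brun_proj_preimage B"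
    by (auto simp: Lambda_ord_def brun_proj_preimage_def)
  then show ?thesis by simp
qed

text \<open>
  The functional equation holds off the lines where two coordinates agree. These form a null set,
  so the integrands agree almost everywhere.
\<close>

lemma emeasure_brun_proj_preimage:
  assumes B: "B \<in> sets borel" "B \<subseteq> Delta"
  shows "emeasure brun_measure (brun_proj_preimage B) = emeasure brun_measure B"
proof -
  note [measurable] = Delta_param_borel sector_map_borel sector_density_borel B(1)
    Delta_borel Lambda_perm_borel branch_domain_borel
  have [measurable]: "branch_density p \<in> borel_measurable borel" for p
    unfolding branch_density_def by measurable
  have sub: "brun_proj_preimage B \<subseteq> Delta" by (auto simp: brun_proj_preimage_def)
  have "emeasure brun_measure (brun_proj_preimage B) =
      (\<integral>\<^sup>+u. (\<Sum>p | p permutes UNIV. ennreal (sector_density p (Delta_param u)) *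
        indicator B (sector_map p (Delta_param u)) *
        indicator (Delta \<inter> Lambda_perm p) (Delta_param u)) \<partial>lborel)"
    unfolding emeasure_brun_measure[OF brun_proj_preimage_borel[OF B(1)] sub]
      brun_density_preimage_eq_sum ..
  also have "\<dots> = (\<Sum>p | p permutes UNIV. \<integral>\<^sup>+u. ennreal (sector_density p (Delta_param u)) *
        indicator B (sector_map p (Delta_param u)) *
        indicator (Delta \<inter> Lambda_perm p) (Delta_param u) \<partial>lborel)"
    by (rule nn_integral_sum) measurable
  also have "\<dots> = (\<Sum>p | p permutes UNIV. \<integral>\<^sup>+v. ennreal (branch_density p (Delta_param v) *
      indicator (branch_domain p) (Delta_param v)) * indicator B (Delta_param v) \<partial>lborel)"
    using B(1) by (intro sum.cong nn_integral_sector) auto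
  also have "\<dots> = (\<integral>\<^sup>+v. (\<Sum>p | p permutes UNIV. ennreal (branch_density p (Delta_param v) *
      indicator (branch_domain p) (Delta_param v)) * indicator B (Delta_param v)) \<partial>lborel)"
    by (rule nn_integral_sum[symmetric]) measurable
  also have "\<dots> = (\<integral>\<^sup>+v. ennreal (brun_density (Delta_param v)) * indicator B (Delta_param v) \<partial>lborel)"
  proof (rule nn_integral_cong_AE)
    show "AE v in lborel. (\<Sum>p | p permutes UNIV. ennreal (branch_density p (Delta_param v) *
      indicator (branch_domain p) (Delta_param v)) * indicator B (Delta_param v)) =
      ennreal (brun_density (Delta_param v)) * indicator B (Delta_param v)"
      using AE_Delta_param_Lambda_ord
    proof (rule eventually_mono)
      fix v assume v: "v \<in> Delta_coords \<longrightarrow> Delta_param v \<in> Lambda_ord"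
      let ?y = "Delta_param v"
      show "(\<Sum>p | p permutes UNIV. ennreal (branch_density p ?y * indicator (branch_domain p) ?y) *
        indicator B ?y) = ennreal (brun_density ?y) * indicator B ?y"
      proof (cases "?y \<in> B")
        case True
        then have y: "?y \<in> Delta \<inter> Lambda_ord"
          using B(2) v by (auto simp flip: Delta_param_in_Delta_iff)
        have "(\<Sum>p | p permutes UNIV. ennreal (branch_density p ?y * indicator (branch_domain p) ?y)) =
            ennreal (\<Sum>p | p permutes UNIV. branch_density p ?y * indicator (branch_domain p) ?y)"
          using y by (intro sum_ennreal) (auto simp: branch_density_nonneg)
        then show ?thesis using True by (simp add: sum_branch_density[OF y])
      qed simp
    qed
  qed
  also have "\<dots> = emeasure brun_measure B"
    by (rule emeasure_brun_measure[OF B, symmetric])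
  finally show ?thesis .
qed

theorem proposition27:
  "brun_density \<in> borel_measurable Delta_lebesgue \<and>
   (\<forall>B. B \<in> sets borel \<longrightarrow> B \<subseteq> Delta \<longrightarrow>
      brun_proj_preimage B \<in> sets borel \<and>
      emeasure brun_measure (brun_proj_preimage B) = emeasure brun_measure B)"
  using brun_density_borel_Delta brun_proj_preimage_borel emeasure_brun_proj_preimage by blast

end
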